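(* Let $\Omega\subseteq\mathbb{H}$ be a speared domain, let $f:\Omega\to\mathbb{H}$ be a slice regular function and let $\{F^{J,K}:D^{J,K}\to\mathbb{H}_{\mathbb{C}}\}_{J,K\in\mathbb{S},J\neq K}$ denote the double-index holomorphic stem family associated to $f$. Fix $J\in\mathbb{S}$ and consider the speared open subset of $\mathbb{R}_{\mathbb{C}}$ \[D^J:=\phi_J^{-1}(\Omega_J^{\geqslant})\cup\overline{\phi_J^{-1}(\Omega_J^{\geqslant})}.\] Then there exists a holomorphic stem function $F^J:D^J\to\mathbb{H}_{\mathbb{C}}$ with the following property: for each $z\in D^J$, there exist a real number $\varepsilon_z>0$ and a speared open neighborhood $U_z$ of $z$ in $D^J$ such that \begin{enumerate} \item $\mathrm{core}_{\mathbb{R}_{\mathbb{C}}}(\Omega)\subseteq U_z$ and $U_z\setminus\mathrm{core}_{\mathbb{R}_{\mathbb{C}}}(\Omega)$ is contained in either $\mathbb{R}_{\mathbb{C}}^{>}$ or $\mathbb{R}_{\mathbb{C}}^{<}$; \item for any choice of distinct $J',K'\in\mathrm{Cap}(J,\varepsilon_z)$, it holds $U_z\subseteq D^{J',K'}$ and $F^{J',K'}_{|U_z}=F^J_{|U_z}$. \end{enumerate} In case $z\in\mathrm{core}_{\mathbb{R}_{\mathbb{C}}}(\Omega)$, we can assume $U_z$ to be $\mathrm{core}_{\mathbb{R}_{\mathbb{C}}}(\Omega)$ and $\varepsilon_z=3$ (whence $\mathrm{Cap}(J,\varepsilon_z)=\mathbb{S}$).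
   Context: Basic notation. $\mathbb{H}$ is the algebra of quaternions (Euclidean topology), $\mathbb{S}=\{w\in\mathbb{H}: w^2=-1\}$. For $I\in\mathbb{S}$: $\mathbb{C}_I=\mathbb{R}+\mathbb{R}I$, $\mathbb{C}_I^{\geqslant}=\{\alpha+\beta I:\alpha,\beta\in\mathbb{R},\beta\ge0\}$. For $T\subseteq\mathbb{H}$: $T_I=T\cap\mathbb{C}_I$, $T_I^{\geqslant}=T\cap\mathbb{C}_I^{\geqslant}$. $\mathrm{Cap}(J,\varepsilon)=\{K\in\mathbb{S}:|K-J|<\varepsilon\}$. A domain is a nonempty connected open subset of $\mathbb{H}$. A function $f:\Omega\to\mathbb{H}$ on a domain is slice regular if for every $I\in\mathbb{S}$ the restriction $f_{|\Omega_I}$ is $C^1$ and $\left(\frac{\partial}{\partial\alpha}+I\frac{\partial}{\partial\beta}\right)f(\alpha+\beta I)=0$ on $\Omega_I$. Stem functions. $\mathbb{H}_{\mathbb{C}}=\mathbb{H}\otimes_{\mathbb{R}}\mathbb{C}=\{x+\imath y: x,y\in\mathbb{H}\}$, with $\imath$ central and $\imath^2=-1$; $\overline{x+\imath y}=x-\imath y$; $\mathbb{R}_{\mathbb{C}}=\mathbb{R}+\imath\mathbb{R}$; $\mathbb{R}_{\mathbb{C}}^{>}$ (resp. $\mathbb{R}_{\mathbb{C}}^{<}$) is the set of $\alpha+\imath\beta$ with $\beta>0$ (resp. $\beta<0$). For $E\subseteq\mathbb{R}_{\mathbb{C}}$, $\overline E$ is its image under conjugation. For $J\in\mathbb{S}$,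 $\phi_J:\mathbb{R}_{\mathbb{C}}\to\mathbb{C}_J$ is the bijection $\alpha+\imath\beta\mapsto\alpha+\beta J$. If $D=\overline D\subseteq\mathbb{R}_{\mathbb{C}}$ is open, a stem function is $F:D\to\mathbb{H}_{\mathbb{C}}$ with $F(\bar z)=\overline{F(z)}$; it is holomorphic if it is so with respect to multiplication by $\imath$. Speared sets. An open $T\subseteq\mathbb{R}_{\mathbb{C}}$ is speared if all its connected components intersect the real axis. An open $U\subseteq\mathbb{H}$ is speared if, for all $I\in\mathbb{S}$, each connected component of $U_I^{\geqslant}$ includes a real point. A speared domain is a domain that is a speared open set. A set $T\subseteq\mathbb{H}$ is symmetric if $\alpha+\beta I\in T$ implies $\alpha+\beta\mathbb{S}\subseteq T$. For $U\subseteq\mathbb{H}$ open, $\mathrm{core}(U)$ is the largest symmetric speared open subset of $U$, and $\mathrm{core}_{\mathbb{R}_{\mathbb{C}}}(U)=\{\alpha+\imath\beta\in\mathbb{R}_{\mathbb{C}}:\alpha+\beta\mathbb{S}\subseteq\mathrm{core}(U)\}$. Double-index holomorphic stem family of $f$. For distinct $J,K\in\mathbb{S}$ set $E^{J,K}=\phi_J^{-1}(\Omega_J^{\geqslant})\cap\phi_K^{-1}(\Omega_K^{\geqslant})$, $D^{J,K}=E^{J,K}\cup\overline{E^{J,K}}$, and let $F^{J,K}:D^{J,K}\to\mathbb{H}_{\mathbb{C}}$ be the holomorphic stem function with \[F^{J,K}(\alpha+\imath\beta)=(J-K)^{-1}[Jf(\alpha+\beta J)-Kf(\alpha+\beta K)]+\imath(J-K)^{-1}[f(\alpha+\beta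 J)-f(\alpha+\beta K)]\] for $\alpha+\imath\beta\in E^{J,K}$, and $F^{J,K}(\bar z)=\overline{F^{J,K}(z)}$. *)

theory Defs
  imports "HOL-Analysis.Analysis"
begin

section \<open>Quaternions\<close>

datatype quat = Quat (q0: real) (q1: real) (q2: real) (q3: real)

lemma quat_eq_iff: "x = y \<longleftrightarrow> q0 x = q0 y \<and> q1 x = q1 y \<and> q2 x = q2 y \<and> q3 x = q3 y"
  by (cases x; cases y) simp

instantiation quat :: ring_1
begin

definition "0 = Quat 0 0 0 0"
definition "1 = Quat 1 0 0 0"
definition "x + y = Quat (q0 x + q0 y) (q1 x + q1 y) (q2 x + q2 y) (q3 x + q3 y)"
definition "- x = Quat (- q0 x) (- q1 x) (- q2 x) (- q3 x)"
definition "x - y = Quat (q0 x - q0 y) (q1 x - q1 y) (q2 x - q2 y) (q3 x - q3 y)"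
definition "x * y = Quat
  (q0 x * q0 y - q1 x * q1 y - q2 x * q2 y - q3 x * q3 y)
  (q0 x * q1 y + q1 x * q0 y + q2 x * q3 y - q3 x * q2 y)
  (q0 x * q2 y - q1 x * q3 y + q2 x * q0 y + q3 x * q1 y)
  (q0 x * q3 y + q1 x * q2 y - q2 x * q1 y + q3 x * q0 y)"

lemmas quat_ring_defs =
  zero_quat_def one_quat_def plus_quat_def uminus_quat_def minus_quat_def times_quat_def

instance
  by standard (simp_all add: quat_eq_iff quat_ring_defs algebra_simps)

end

instantiation quat :: real_algebra_1
begin

definition "scaleR r x = Quat (r * q0 x) (r * q1 x) (r * q2 x) (r * q3 x)"

instance
  by standard (simp_all add: quat_eq_iff quat_ring_defs scaleR_quat_def algebra_simps)

end

instantiation quat :: real_inner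
begin

definition inner_quat :: "quat \<Rightarrow> quat \<Rightarrow> real"
  where "inner_quat x y = q0 x * q0 y + q1 x * q1 y + q2 x * q2 y + q3 x * q3 y"
definition norm_quat :: "quat \<Rightarrow> real"
  where "norm_quat x = sqrt (inner x x)"
definition sgn_quat :: "quat \<Rightarrow> quat"
  where "sgn_quat x = x /\<^sub>R norm x"
definition dist_quat :: "quat \<Rightarrow> quat \<Rightarrow> real"
  where "dist_quat x y = norm (x - y)"
definition uniformity_quat :: "(quat \<times> quat) filter"
  where "uniformity_quat = (INF e\<in>{0 <..}. principal {(x, y). dist x y < e})"
definition open_quat :: "quat set \<Rightarrow> bool"
  where "open_quat U \<longleftrightarrow> (\<forall>x\<in>U. eventually (\<lambda>(x', y). x' = x \<longrightarrow> y \<in> U) uniformity)"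

instance
proof
  fix x y z :: quat and r :: real and U :: "quat set"
  show "sgn x = x /\<^sub>R norm x" by (rule sgn_quat_def)
  show "dist x y = norm (x - y)" by (rule dist_quat_def)
  show "uniformity = (INF e\<in>{0 <..}. principal {(x::quat, y). dist x y < e})"
    by (rule uniformity_quat_def)
  show "open U \<longleftrightarrow> (\<forall>x\<in>U. eventually (\<lambda>(x', y). x' = x \<longrightarrow> y \<in> U) uniformity)"
    by (rule open_quat_def)
  show "inner x y = inner y x" by (simp add: inner_quat_def mult.commute)
  show "inner (x + y) z = inner x z + inner y z"
    by (simp add: inner_quat_def plus_quat_def algebra_simps)
  show "inner (scaleR r x) y = r * inner x y"
    by (simp add: inner_quat_def scaleR_quat_def algebra_simps)
  show "0 \<le> inner x x" by (simp add: inner_quat_def)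
  show "inner x x = 0 \<longleftrightarrow> x = 0"
    proof -
    have "(a * a + b * b) + (c * c + d * d) = 0 \<longleftrightarrow> a = 0 \<and> b = 0 \<and> c = 0 \<and> d = 0" for a b c d :: real
      by (subst add_nonneg_eq_0_iff) (simp_all add: sum_squares_eq_zero_iff)
    then show ?thesis by (simp add: inner_quat_def zero_quat_def quat_eq_iff add.assoc)
  qed
  show "norm x = sqrt (inner x x)" by (rule norm_quat_def)
qed

end

instantiation quat :: division_ring
begin

definition inverse_quat :: "quat \<Rightarrow> quat"
  where "inverse_quat x = Quat (q0 x) (- q1 x) (- q2 x) (- q3 x) /\<^sub>R inner x x"
definition divide_quat :: "quat \<Rightarrow> quat \<Rightarrow> quat"
  where "divide_quat x y = x * inverse y"

instance
proof
  fix x y :: quat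
  have L: "Quat (q0 x) (- q1 x) (- q2 x) (- q3 x) * x = inner x x *\<^sub>R 1"
    by (simp add: quat_eq_iff times_quat_def one_quat_def scaleR_quat_def inner_quat_def algebra_simps)
  have R: "x * Quat (q0 x) (- q1 x) (- q2 x) (- q3 x) = inner x x *\<^sub>R 1"
    by (simp add: quat_eq_iff times_quat_def one_quat_def scaleR_quat_def inner_quat_def algebra_simps)
  show "x \<noteq> 0 \<Longrightarrow> inverse x * x = 1" by (simp add: inverse_quat_def L)
  show "x \<noteq> 0 \<Longrightarrow> x * inverse x = 1" by (simp add: inverse_quat_def R)
  show "inverse (0::quat) = 0" by (simp add: inverse_quat_def)
  show "divide x y = x * inverse y" by (rule divide_quat_def)
qed

end

instance quat :: real_normed_div_algebra
proof
  fix x y :: quat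
  have "inner (x * y) (x * y) = inner x x * inner y y"
    by (simp add: inner_quat_def times_quat_def algebra_simps)
  then show "norm (x * y) = norm x * norm y"
    by (simp add: norm_quat_def real_sqrt_mult)
qed

instantiation quat :: euclidean_space
begin

definition Basis_quat :: "quat set"
  where "Basis_quat = {Quat 1 0 0 0, Quat 0 1 0 0, Quat 0 0 1 0, Quat 0 0 0 1}"

instance
proof
  fix u v x :: quat
  show "(Basis :: quat set) \<noteq> {}" "finite (Basis :: quat set)" by (simp_all add: Basis_quat_def)
  show "u \<in> Basis \<Longrightarrow> v \<in> Basis \<Longrightarrow> inner u v = (if u = v then 1 else 0)"
    unfolding Basis_quat_def by (elim insertE emptyE; simp add: inner_quat_def)
  show "(\<forall>u\<in>Basis. inner x u = 0) \<longleftrightarrow> x = 0"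
    by (cases x) (simp add: Basis_quat_def inner_quat_def zero_quat_def)
qed

end


section \<open>Slices and slice regular functions\<close>

text \<open>The real algebra \<open>R + \<iota>R\<close> is rendered by the type \<^typ>\<open>complex\<close>, with \<open>\<iota>\<close> as \<^term>\<open>\<i>\<close>;
  the real quaternions are \<^term>\<open>\<real> :: quat set\<close>.\<close>

definition imag_sphere :: "quat set"
  where "imag_sphere = {w. w\<^sup>2 = -1}"

definition phi :: "quat \<Rightarrow> complex \<Rightarrow> quat"
  where "phi J z = of_real (Re z) + of_real (Im z) * J"

definition half_slice :: "quat set \<Rightarrow> quat \<Rightarrow> quat set"
  where "half_slice T I = T \<inter> {of_real \<alpha> + of_real \<beta> * I | \<alpha> \<beta>. \<beta> \<ge> 0}"

definition Cap :: "quat \<Rightarrow> real \<Rightarrow> quat set"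
  where "Cap J \<epsilon> = {K \<in> imag_sphere. norm (K - J) < \<epsilon>}"

definition quat_domain :: "quat set \<Rightarrow> bool"
  where "quat_domain \<Omega> \<longleftrightarrow> open \<Omega> \<and> connected \<Omega> \<and> \<Omega> \<noteq> {}"

text \<open>In the coordinate \<open>\<alpha> + \<iota>\<beta>\<close> on the slice of \<open>I\<close>, the restriction of \<open>f\<close> is \<open>f \<circ> phi I\<close>. Its
  real Frechet derivative \<open>g'\<close> is required to be continuous (class C1), and the values of \<open>g' z\<close>
  at \<open>1\<close> and \<open>\<i>\<close> are the partial derivatives with respect to \<open>\<alpha>\<close> and \<open>\<beta>\<close>.\<close>

definition slice_regular_on :: "quat set \<Rightarrow> (quat \<Rightarrow> quat) \<Rightarrow> bool"
  where "slice_regular_on \<Omega> f \<longleftrightarrow>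
    (\<forall>I\<in>imag_sphere. \<exists>g' :: complex \<Rightarrow> complex \<Rightarrow>\<^sub>L quat.
       continuous_on (phi I -` \<Omega>) g' \<and>
       (\<forall>z \<in> phi I -` \<Omega>.
          ((f \<circ> phi I) has_derivative blinfun_apply (g' z)) (at z) \<and>
          blinfun_apply (g' z) 1 + I * blinfun_apply (g' z) \<i> = 0))"


section \<open>Stem functions\<close>

text \<open>The pair \<open>(x, y)\<close> stands for the element \<open>x + \<iota>y\<close> of the complexified quaternions.\<close>

type_synonym cquat = "quat \<times> quat"

definition cquat_mult :: "cquat \<Rightarrow> cquat \<Rightarrow> cquat"
  where "cquat_mult v w =
    (fst v * fst w - snd v * snd w, fst v * snd w + snd v * fst w)"

definition cquat_cnj :: "cquat \<Rightarrow> cquat"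
  where "cquat_cnj w = (fst w, - snd w)"

definition cquat_of_complex :: "complex \<Rightarrow> cquat"
  where "cquat_of_complex z = (of_real (Re z), of_real (Im z))"

definition stem_function_on :: "complex set \<Rightarrow> (complex \<Rightarrow> cquat) \<Rightarrow> bool"
  where "stem_function_on D F \<longleftrightarrow>
    open D \<and> cnj ` D = D \<and> (\<forall>z\<in>D. F (cnj z) = cquat_cnj (F z))"

definition holomorphic_stem_on :: "complex set \<Rightarrow> (complex \<Rightarrow> cquat) \<Rightarrow> bool"
  where "holomorphic_stem_on D F \<longleftrightarrow>
    stem_function_on D F \<and>
    (\<forall>z\<in>D. \<exists>w. (F has_derivative (\<lambda>h. cquat_mult (cquat_of_complex h) w)) (at z))"


section \<open>Speared sets and cores\<close>

definition speared_open_RC :: "complex set \<Rightarrow> bool"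
  where "speared_open_RC T \<longleftrightarrow> open T \<and> (\<forall>C \<in> components T. C \<inter> \<real> \<noteq> {})"

definition speared_open :: "quat set \<Rightarrow> bool"
  where "speared_open U \<longleftrightarrow>
    open U \<and> (\<forall>I\<in>imag_sphere. \<forall>C \<in> components (half_slice U I). C \<inter> \<real> \<noteq> {})"

definition symmetric :: "quat set \<Rightarrow> bool"
  where "symmetric T \<longleftrightarrow>
    (\<forall>\<alpha> \<beta>. \<forall>I\<in>imag_sphere. of_real \<alpha> + of_real \<beta> * I \<in> T \<longrightarrow>
       (\<forall>K\<in>imag_sphere. of_real \<alpha> + of_real \<beta> * K \<in> T))"

definition core :: "quat set \<Rightarrow> quat set"
  where "core U = \<Union>{V. V \<subseteq> U \<and> symmetric V \<and> speared_open V}"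

lemma speared_open_Union:
  assumes "\<And>V. V \<in> \<V> \<Longrightarrow> speared_open V"
  shows "speared_open (\<Union>\<V>)"
  unfolding speared_open_def
proof (intro conjI ballI)
  show "open (\<Union>\<V>)" using assms by (auto simp: speared_open_def)
next
  fix I C assume I: "I \<in> imag_sphere" and C: "C \<in> components (half_slice (\<Union>\<V>) I)"
  obtain x where x: "x \<in> half_slice (\<Union>\<V>) I" "C = connected_component_set (half_slice (\<Union>\<V>) I) x"
    using C by (auto simp: components_def)
  then obtain V where V: "V \<in> \<V>" "x \<in> half_slice V I" by (auto simp: half_slice_def)
  let ?B = "connected_component_set (half_slice V I) x"
  have "?B \<in> components (half_slice V I)" using V by (auto simp: components_def)
  then have "?B \<inter> \<real> \<noteq> {}" using assms[OF V(1)] I by (auto simp: speared_open_def)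
  moreover have "?B \<subseteq> C"
    unfolding x(2) using V(1) by (intro connected_component_mono) (auto simp: half_slice_def)
  ultimately show "C \<inter> \<real> \<noteq> {}" by blast
qed

text \<open>The core is indeed the largest symmetric speared open subset.\<close>

lemma core_largest:
  "core U \<subseteq> U" "symmetric (core U)" "speared_open (core U)"
  "V \<subseteq> U \<Longrightarrow> symmetric V \<Longrightarrow> speared_open V \<Longrightarrow> V \<subseteq> core U"
proof -
  show "core U \<subseteq> U" by (auto simp: core_def)
  show "speared_open (core U)" unfolding core_def by (rule speared_open_Union) blast
  show "symmetric (core U)" unfolding core_def symmetric_def by blast
  show "V \<subseteq> U \<Longrightarrow> symmetric V \<Longrightarrow> speared_open V \<Longrightarrow> V \<subseteq> core U"
    by (auto simp: core_def)
qed

definition core_RC :: "quat set \<Rightarrow> complex set"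
  where "core_RC U = {z. \<forall>I\<in>imag_sphere. of_real (Re z) + of_real (Im z) * I \<in> core U}"


section \<open>The double-index stem family\<close>

definition D1 :: "quat set \<Rightarrow> quat \<Rightarrow> complex set"
  where "D1 \<Omega> J = phi J -` half_slice \<Omega> J \<union> cnj ` (phi J -` half_slice \<Omega> J)"

definition E2 :: "quat set \<Rightarrow> quat \<Rightarrow> quat \<Rightarrow> complex set"
  where "E2 \<Omega> J K = phi J -` half_slice \<Omega> J \<inter> phi K -` half_slice \<Omega> K"

definition D2 :: "quat set \<Rightarrow> quat \<Rightarrow> quat \<Rightarrow> complex set"
  where "D2 \<Omega> J K = E2 \<Omega> J K \<union> cnj ` E2 \<Omega> J K"

definition F2_formula :: "(quat \<Rightarrow> quat) \<Rightarrow> quat \<Rightarrow> quat \<Rightarrow> complex \<Rightarrow> cquat"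
  where "F2_formula f J K z =
    (inverse (J - K) * (J * f (phi J z) - K * f (phi K z)),
     inverse (J - K) * (f (phi J z) - f (phi K z)))"

text \<open>Only the values on \<open>D2 \<Omega> J K\<close> with distinct \<open>J\<close>, \<open>K\<close> are meaningful. At the real points,
  where both branches of the definition apply, they agree.\<close>

definition F2 :: "quat set \<Rightarrow> (quat \<Rightarrow> quat) \<Rightarrow> quat \<Rightarrow> quat \<Rightarrow> complex \<Rightarrow> cquat"
  where "F2 \<Omega> f J K z =
    (if z \<in> E2 \<Omega> J K then F2_formula f J K z else cquat_cnj (F2_formula f J K (cnj z)))"

end

theory Submission
  imports Defs "HOL-Complex_Analysis.Conformal_Mappings"
begin

text \<open>Two holomorphic stem functions on a speared set that agree at its real points are equal. Since
  every \<open>F2 \<Omega> f J K\<close> takes the value \<open>(f x, 0)\<close> at a real point \<open>x\<close>, all members of the family agree on any speared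
  set that \<open>phi\<close> maps into \<open>\<Omega>\<close> for all the indices involved. Around \<open>z\<close> in the upper half-plane such
  a set is the union of the core and a thin tube about a path from \<open>z\<close> to a real point; compactness
  of the path allows the indices to vary in a small cap about \<open>J\<close>. The lower half-plane follows by
  conjugation.\<close>

section \<open>Slices\<close>

text \<open>The formula excludes equal indices, so the single-index function cannot be obtained by
  substituting \<open>J\<close> for both; it is the common value of all pairs of distinct indices
  near \<open>J\<close>. The size of the cap must depend on the point: away from the core,
  neighbouring half slices of \<open>\<Omega>\<close> can differ, and a pair far from
  \<open>J\<close> may not have the point in its domain. The obstacle is the real axis. A tube that
  follows a path down to it also enters the lower half-plane, where \<open>F2\<close> is defined by
  conjugation and no longer by its formula. This is harmless because real points of
  \<open>\<Omega>\<close> lie in the core, so the tube can be kept so thin that its points on or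
  below the axis are core points. The core is invariant under conjugation, and the identity
  principle applied to it shows that the two branches of \<open>F2\<close> agree there.\<close>

lemma of_real_quat: "of_real r = Quat r 0 0 0"
  by (simp add: of_real_def scaleR_quat_def one_quat_def)

lemma imag_sphere_iff: "J \<in> imag_sphere \<longleftrightarrow> q0 J = 0 \<and> (q1 J)\<^sup>2 + (q2 J)\<^sup>2 + (q3 J)\<^sup>2 = 1"
proof
  assume "J \<in> imag_sphere"
  then have eq: "q0 J * q0 J - q1 J * q1 J - q2 J * q2 J - q3 J * q3 J = -1"
      "q0 J * q1 J = 0" "q0 J * q2 J = 0" "q0 J * q3 J = 0"
    by (simp_all add: imag_sphere_def power2_eq_square quat_eq_iff quat_ring_defs algebra_simps)
  have "q0 J = 0"
  proof (rule ccontr)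
    assume "q0 J \<noteq> 0"
    with eq have "q0 J * q0 J = -1" by simp
    then show False using zero_le_square[of "q0 J"] by linarith
  qed
  with eq(1) show "q0 J = 0 \<and> (q1 J)\<^sup>2 + (q2 J)\<^sup>2 + (q3 J)\<^sup>2 = 1"
    by (simp add: power2_eq_square)
next
  assume "q0 J = 0 \<and> (q1 J)\<^sup>2 + (q2 J)\<^sup>2 + (q3 J)\<^sup>2 = 1"
  then show "J \<in> imag_sphere"
    by (simp add: imag_sphere_def power2_eq_square quat_eq_iff quat_ring_defs)
qed

lemma imag_sphere_square: "J \<in> imag_sphere \<Longrightarrow> J * J = -1"
  by (simp add: imag_sphere_def power2_eq_square)

lemma imag_sphere_norm: "J \<in> imag_sphere \<Longrightarrow> norm J = 1"
  by (simp add: imag_sphere_iff norm_quat_def inner_quat_def power2_eq_square)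

lemma imag_sphere_uminus: "J \<in> imag_sphere \<Longrightarrow> - J \<in> imag_sphere"
  by (simp add: imag_sphere_def)

lemma phi_quat:
  "phi J z = Quat (Re z + Im z * q0 J) (Im z * q1 J) (Im z * q2 J) (Im z * q3 J)"
  by (simp add: phi_def quat_eq_iff of_real_quat quat_ring_defs)

lemma bounded_linear_phi: "bounded_linear (phi J)"
proof -
  have "linear (phi J)"
    by (rule linearI) (simp_all add: phi_quat quat_eq_iff plus_quat_def scaleR_quat_def algebra_simps)
  then show ?thesis by (simp add: linear_conv_bounded_linear)
qed

lemma continuous_on_phi [continuous_intros]: "continuous_on S (phi J)"
  by (rule linear_continuous_on[OF bounded_linear_phi])

lemma phi_of_real [simp]: "phi J (of_real x) = of_real x"
  by (simp add: phi_def)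

lemma phi_cnj: "phi J (cnj z) = phi (- J) z"
  by (simp add: phi_def)

text \<open>The coordinates in the slice are inner products with the orthonormal vectors
  \<open>1\<close> and \<open>J\<close>. This left inverse is defined and continuous on all
  quaternions, so connected subsets of a slice can be pulled back to the plane.\<close>

lemma phi_inverse:
  assumes "J \<in> imag_sphere"
  shows "Complex (q0 (phi J z)) (inner (phi J z) J) = z"
proof -
  have "q0 J = 0" using assms unfolding imag_sphere_iff by blast
  then have "inner (phi J z) J = Im z * ((q1 J)\<^sup>2 + (q2 J)\<^sup>2 + (q3 J)\<^sup>2)"
    by (simp add: phi_quat inner_quat_def power2_eq_square algebra_simps)
  then show ?thesis using assms unfolding imag_sphere_iff by (simp add: phi_quat complex_eq_iff)
qed

lemma phi_inj: "J \<in> imag_sphere \<Longrightarrow> phi J z = phi J w \<Longrightarrow> z = w"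
  by (metis phi_inverse)

lemma phi_real_iff:
  assumes "J \<in> imag_sphere"
  shows "phi J z \<in> \<real> \<longleftrightarrow> z \<in> \<real>"
proof
  assume "phi J z \<in> \<real>"
  then obtain r where "phi J z = phi J (of_real r)" by (auto elim: Reals_cases)
  then show "z \<in> \<real>" using phi_inj[OF assms] by (metis Reals_of_real)
qed (auto elim: Reals_cases)

lemma half_slice_eq: "half_slice T I = phi I ` {z. Im z \<ge> 0} \<inter> T"
proof -
  have "{of_real \<alpha> + of_real \<beta> * I | \<alpha> \<beta>. \<beta> \<ge> 0} = phi I ` {z. Im z \<ge> 0}" (is "?L = _")
  proof
    show "?L \<subseteq> phi I ` {z. Im z \<ge> 0}"
    proof clarify
      fix \<alpha> \<beta> :: real assume "\<beta> \<ge> 0"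
      then show "of_real \<alpha> + of_real \<beta> * I \<in> phi I ` {z. Im z \<ge> 0}"
        by (intro image_eqI[of _ _ "Complex \<alpha> \<beta>"]) (auto simp: phi_def)
    qed
  qed (auto simp: phi_def)
  then show ?thesis by (auto simp: half_slice_def)
qed

lemma phi_vimage_half_slice:
  assumes "J \<in> imag_sphere"
  shows "phi J -` half_slice T J = {z. Im z \<ge> 0 \<and> phi J z \<in> T}"
  using phi_inj[OF assms] unfolding half_slice_eq by blast

lemma mem_E2_iff:
  assumes "J \<in> imag_sphere" "K \<in> imag_sphere"
  shows "z \<in> E2 \<Omega> J K \<longleftrightarrow> Im z \<ge> 0 \<and> phi J z \<in> \<Omega> \<and> phi K z \<in> \<Omega>"
  using assms by (auto simp: E2_def phi_vimage_half_slice)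

lemma mem_image_cnj_iff: "z \<in> cnj ` S \<longleftrightarrow> cnj z \<in> S"
  by (force intro: image_eqI[of _ _ "cnj z"])

lemma mem_D2_iff: "z \<in> D2 \<Omega> J K \<longleftrightarrow> z \<in> E2 \<Omega> J K \<or> cnj z \<in> E2 \<Omega> J K"
  by (simp add: D2_def mem_image_cnj_iff)

lemma mem_D1_iff:
  assumes "J \<in> imag_sphere"
  shows "z \<in> D1 \<Omega> J \<longleftrightarrow> Im z \<ge> 0 \<and> phi J z \<in> \<Omega> \<or> Im z \<le> 0 \<and> phi J (cnj z) \<in> \<Omega>"
  using assms by (simp add: D1_def phi_vimage_half_slice mem_image_cnj_iff)

lemma cnj_D1_iff: "cnj z \<in> D1 \<Omega> J \<longleftrightarrow> z \<in> D1 \<Omega> J"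
  by (auto simp: D1_def mem_image_cnj_iff)

section \<open>Caps on the sphere of imaginary units\<close>

lemma islimpt_imag_sphere:
  assumes "J \<in> imag_sphere"
  shows "J islimpt imag_sphere"
proof -
  let ?h = "\<lambda>v::real \<times> real \<times> real.
    fst v *\<^sub>R Quat 0 1 0 0 + fst (snd v) *\<^sub>R Quat 0 0 1 0 + snd (snd v) *\<^sub>R Quat 0 0 0 1"
  have h: "?h v = Quat 0 (fst v) (fst (snd v)) (snd (snd v))" for v
    by (simp add: quat_eq_iff scaleR_quat_def plus_quat_def)
  \<comment> \<open>The sphere is a copy of the unit sphere of a three-dimensional space, hence
    connected; a connected set with more than one point has no isolated points.\<close>
  have "imag_sphere = ?h ` sphere 0 1"
  proof (intro set_eqI iffI)
    fix w assume "w \<in> imag_sphere"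
    then have "w = ?h (q1 w, q2 w, q3 w)" "(q1 w, q2 w, q3 w) \<in> sphere 0 1"
      unfolding h by (auto simp: imag_sphere_iff quat_eq_iff norm_Pair dist_norm)
    then show "w \<in> ?h ` sphere 0 1" by blast
  next
    fix w assume "w \<in> ?h ` sphere 0 1"
    then show "w \<in> imag_sphere"
      unfolding h by (auto simp: imag_sphere_iff norm_Pair dist_norm)
  qed
  moreover have "connected (?h ` sphere 0 1)"
    by (intro connected_continuous_image connected_sphere continuous_intros) simp
  ultimately have "connected imag_sphere" by simp
  moreover have "imag_sphere \<noteq> {K}" for K
  proof
    assume "imag_sphere = {K}"
    moreover have "Quat 0 1 0 0 \<in> imag_sphere" "Quat 0 0 1 0 \<in> imag_sphere"
      by (auto simp: imag_sphere_iff)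
    ultimately have "Quat 0 1 0 0 = Quat 0 0 1 0" by (metis singletonD)
    then show False by simp
  qed
  ultimately show ?thesis using assms connected_imp_perfect by metis
qed

lemma Cap_self: "J \<in> imag_sphere \<Longrightarrow> \<epsilon> > 0 \<Longrightarrow> J \<in> Cap J \<epsilon>"
  by (simp add: Cap_def)

text \<open>Every cap contains a pair of distinct indices, so statements about all such pairs are
  never vacuous and do determine a value.\<close>

lemma Cap_other:
  assumes "J \<in> imag_sphere" "\<epsilon> > 0"
  obtains K where "K \<in> Cap J \<epsilon>" "K \<noteq> J"
  using islimpt_imag_sphere[OF assms(1)] assms(2)
  unfolding islimpt_approachable Cap_def dist_norm by blast

text \<open>Two unit vectors are at distance at most 2.\<close>

lemma Cap_3:
  assumes "J \<in> imag_sphere"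
  shows "Cap J 3 = imag_sphere"
proof -
  have "norm (K - J) < 3" if "K \<in> imag_sphere" for K
    using norm_triangle_ineq4[of K J] imag_sphere_norm[OF that] imag_sphere_norm[OF assms] by simp
  then show ?thesis by (auto simp: Cap_def)
qed


section \<open>Speared sets\<close>

text \<open>A connected witness need not be a whole component, which is what makes spearedness pass
  easily to unions, to conjugates and to tubes.\<close>

lemma speared_open_RC_iff:
  "speared_open_RC T \<longleftrightarrow>
    open T \<and> (\<forall>z\<in>T. \<exists>C. connected C \<and> C \<subseteq> T \<and> z \<in> C \<and> C \<inter> \<real> \<noteq> {})"
proof -
  have "(\<forall>C \<in> components T. C \<inter> \<real> \<noteq> {}) \<longleftrightarrow>
    (\<forall>z\<in>T. \<exists>C. connected C \<and> C \<subseteq> T \<and> z \<in> C \<and> C \<inter> \<real> \<noteq> {})" (is "?L \<longleftrightarrow> ?R")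
  proof
    assume L: ?L
    show ?R
    proof
      fix z assume z: "z \<in> T"
      let ?C = "connected_component_set T z"
      from z have "?C \<in> components T" by (auto simp: components_def)
      with L have "?C \<inter> \<real> \<noteq> {}" by blast
      with z show "\<exists>C. connected C \<and> C \<subseteq> T \<and> z \<in> C \<and> C \<inter> \<real> \<noteq> {}"
        by (intro exI[of _ ?C]) (auto simp: connected_component_subset connected_component_refl
              dest: connected_component_in)
    qed
  next
    assume R: ?R
    show ?L
    proof
      fix C assume "C \<in> components T"
      then obtain z where z: "z \<in> T" "C = connected_component_set T z" by (auto simp: components_def)
      with R obtain B where "connected B" "B \<subseteq> T" "z \<in> B" "B \<inter> \<real> \<noteq> {}" by blast
      moreover from this have "B \<subseteq> C" unfolding z(2) by (intro connected_component_maximal)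
      ultimately show "C \<inter> \<real> \<noteq> {}" by blast
    qed
  qed
  then show ?thesis by (simp add: speared_open_RC_def)
qed

lemma speared_open_RC_Union:
  assumes "\<And>T. T \<in> \<T> \<Longrightarrow> speared_open_RC T"
  shows "speared_open_RC (\<Union>\<T>)"
  using assms unfolding speared_open_RC_iff by (metis Union_iff Union_upper open_Union subset_trans)

lemma open_image_cnj: "open S \<Longrightarrow> open (cnj ` S)"
proof -
  have "cnj ` S = cnj -` S" by (auto simp: mem_image_cnj_iff)
  moreover have "open S \<Longrightarrow> open (cnj -` S)"
    by (intro open_vimage continuous_intros) auto
  ultimately show "open S \<Longrightarrow> open (cnj ` S)" by simp
qed

lemma speared_open_RC_cnj:
  assumes "speared_open_RC T"
  shows "speared_open_RC (cnj ` T)"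
  unfolding speared_open_RC_iff
proof (intro conjI ballI)
  show "open (cnj ` T)" using assms by (simp add: speared_open_RC_def open_image_cnj)
  fix z assume "z \<in> cnj ` T"
  then obtain C where C: "connected C" "C \<subseteq> T" "cnj z \<in> C" "C \<inter> \<real> \<noteq> {}"
    using assms unfolding speared_open_RC_iff mem_image_cnj_iff by blast
  have "connected (cnj ` C)" using C(1) by (intro connected_continuous_image continuous_intros)
  moreover have "cnj ` C \<subseteq> cnj ` T" "z \<in> cnj ` C" using C by (auto simp: mem_image_cnj_iff)
  moreover obtain x :: real where "of_real x \<in> C" using C(4) by (auto elim: Reals_cases)
  then have "of_real x \<in> cnj ` C \<inter> \<real>" by (simp add: mem_image_cnj_iff)
  ultimately show "\<exists>C. connected C \<and> C \<subseteq> cnj ` T \<and> z \<in> C \<and> C \<inter> \<real> \<noteq> {}" by blast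
qed

text \<open>Moves spearedness from the quaternionic half slice to the plane: the component of
  \<open>phi I z\<close> is pulled back along the explicit left inverse of
  \<open>phi I\<close>.\<close>

lemma upper_half_slice_reaches_real:
  assumes U: "speared_open U" and I: "I \<in> imag_sphere" and z: "Im z \<ge> 0" "phi I z \<in> U"
  obtains C where "connected C" "C \<subseteq> {w. Im w \<ge> 0 \<and> phi I w \<in> U}" "z \<in> C" "C \<inter> \<real> \<noteq> {}"
proof -
  let ?B = "connected_component_set (half_slice U I) (phi I z)"
  let ?g = "\<lambda>q. Complex (q0 q) (inner q I)"
  have q0: "q0 q = inner q 1" for q by (simp add: inner_quat_def one_quat_def)
  have zin: "phi I z \<in> half_slice U I" using z by (auto simp: half_slice_eq)
  then have "?B \<in> components (half_slice U I)" by (auto simp: components_def)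
  then have "?B \<inter> \<real> \<noteq> {}" using U I by (auto simp: speared_open_def)
  then obtain w where w: "w \<in> ?B" "w \<in> \<real>" by blast
  have sub: "?B \<subseteq> half_slice U I" by (rule connected_component_subset)
  have g: "\<exists>v. Im v \<ge> 0 \<and> phi I v = q \<and> ?g q = v \<and> phi I v \<in> U" if "q \<in> ?B" for q
  proof -
    have "q \<in> half_slice U I" using that sub by blast
    then obtain v where "Im v \<ge> 0" "q = phi I v" "q \<in> U" unfolding half_slice_eq by blast
    then show ?thesis using phi_inverse[OF I, of v] by blast
  qed
  show ?thesis
  proof
    show "connected (?g ` ?B)"
      \<comment> \<open>Once the real part is written as the inner product with \<open>1\<close>,
        the left inverse is visibly continuous.\<close>
      unfolding Complex_eq q0
      by (intro connected_continuous_image continuous_intros connected_connected_component)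
    show "?g ` ?B \<subseteq> {w. Im w \<ge> 0 \<and> phi I w \<in> U}" using g by blast
    have "phi I z \<in> ?B" using zin by (simp add: connected_component_refl)
    then show "z \<in> ?g ` ?B" by (rule image_eqI[of _ ?g, OF phi_inverse[OF I, symmetric]])
    obtain v where "phi I v = w" "?g w = v" using g w(1) by blast
    then have "?g w \<in> \<real>" using w(2) phi_real_iff[OF I, of v] by simp
    then show "?g ` ?B \<inter> \<real> \<noteq> {}" using w(1) by blast
  qed
qed

section \<open>The core and its counterpart in the plane\<close>

lemma symmetric_phi:
  "symmetric T \<Longrightarrow> I \<in> imag_sphere \<Longrightarrow> K \<in> imag_sphere \<Longrightarrow> phi I z \<in> T \<Longrightarrow> phi K z \<in> T"
  unfolding symmetric_def phi_def by blast

text \<open>The core is symmetric, so a single slice decides membership; topological questions about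
  \<open>core_RC\<close> can then be settled in one fixed slice.\<close>

lemma mem_core_RC_iff:
  assumes "I \<in> imag_sphere"
  shows "z \<in> core_RC \<Omega> \<longleftrightarrow> phi I z \<in> core \<Omega>"
  using symmetric_phi[OF core_largest(2) assms] assms
  by (auto simp: core_RC_def phi_def)

lemma phi_core_RC: "z \<in> core_RC \<Omega> \<Longrightarrow> I \<in> imag_sphere \<Longrightarrow> phi I z \<in> \<Omega>"
  using mem_core_RC_iff core_largest(1) by blast

lemma quat_i_in_imag_sphere: "Quat 0 1 0 0 \<in> imag_sphere"
  by (simp add: imag_sphere_iff)

text \<open>Conjugating the point amounts to passing to the opposite index, and membership does not
  depend on the index.\<close>

lemma cnj_core_RC_iff: "cnj z \<in> core_RC \<Omega> \<longleftrightarrow> z \<in> core_RC \<Omega>"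
  using mem_core_RC_iff[OF quat_i_in_imag_sphere, of "cnj z"]
    mem_core_RC_iff[OF imag_sphere_uminus[OF quat_i_in_imag_sphere], of z]
  by (simp add: phi_cnj)

lemma cnj_image_core_RC: "cnj ` core_RC \<Omega> = core_RC \<Omega>"
  by (auto simp: mem_image_cnj_iff cnj_core_RC_iff)

lemma open_core_RC: "open (core_RC \<Omega>)"
proof -
  have "core_RC \<Omega> = phi (Quat 0 1 0 0) -` core \<Omega>"
    using mem_core_RC_iff[OF quat_i_in_imag_sphere] by auto
  moreover have "open (core \<Omega>)" using core_largest(3) by (simp add: speared_open_def)
  ultimately show ?thesis by (auto intro!: open_vimage continuous_intros)
qed

text \<open>Spearedness of the core only speaks of closed upper half slices; points below the axis
  are reached by reflecting the connected set found for their conjugates.\<close>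

lemma speared_core_RC: "speared_open_RC (core_RC \<Omega>)"
proof -
  let ?T = "{w. Im w \<ge> 0 \<and> w \<in> core_RC \<Omega>}"
  have upper: "\<exists>C. connected C \<and> C \<subseteq> core_RC \<Omega> \<and> z \<in> C \<and> C \<inter> \<real> \<noteq> {}" if "z \<in> ?T" for z
  proof -
    have "phi (Quat 0 1 0 0) z \<in> core \<Omega>"
      using that mem_core_RC_iff[OF quat_i_in_imag_sphere] by blast
    moreover have "Im z \<ge> 0" using that by blast
    ultimately obtain C where C: "connected C" "z \<in> C" "C \<inter> \<real> \<noteq> {}"
      "C \<subseteq> {w. Im w \<ge> 0 \<and> phi (Quat 0 1 0 0) w \<in> core \<Omega>}"
      using upper_half_slice_reaches_real[OF core_largest(3) quat_i_in_imag_sphere] by metis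
    from C(4) have "C \<subseteq> core_RC \<Omega>" by (auto simp: mem_core_RC_iff[OF quat_i_in_imag_sphere])
    with C show ?thesis by blast
  qed
  have "\<exists>C. connected C \<and> C \<subseteq> core_RC \<Omega> \<and> z \<in> C \<and> C \<inter> \<real> \<noteq> {}" if z: "z \<in> core_RC \<Omega>" for z
  proof (cases "Im z \<ge> 0")
    case False
    then obtain C where C: "connected C" "C \<subseteq> core_RC \<Omega>" "cnj z \<in> C" "C \<inter> \<real> \<noteq> {}"
      using upper[of "cnj z"] z by (auto simp: cnj_core_RC_iff)
    have "connected (cnj ` C)" using C(1) by (intro connected_continuous_image continuous_intros)
    moreover have "cnj ` C \<subseteq> core_RC \<Omega>" "z \<in> cnj ` C"
      using C by (auto simp: mem_image_cnj_iff cnj_core_RC_iff)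
    moreover obtain x :: real where "of_real x \<in> C" using C(4) by (auto elim: Reals_cases)
    then have "of_real x \<in> cnj ` C \<inter> \<real>" by (simp add: mem_image_cnj_iff)
    ultimately show ?thesis by blast
  qed (use upper z in auto)
  then show ?thesis unfolding speared_open_RC_iff using open_core_RC by blast
qed

text \<open>A ball about a real point is itself symmetric and speared: the distance from its centre
  to \<open>\<alpha> + \<beta> I\<close> is independent of the unit \<open>I\<close>, and its half
  slices are convex and contain the centre.\<close>

lemma real_mem_core:
  assumes "open \<Omega>" "of_real x \<in> \<Omega>"
  shows "of_real x \<in> core \<Omega>"
proof -
  obtain r where r: "r > 0" "ball (of_real x) r \<subseteq> \<Omega>" using assms open_contains_ball by blast
  let ?B = "ball (of_real x :: quat) r"
  have d: "dist (of_real x) (phi I z) = cmod (of_real x - z)" if "I \<in> imag_sphere" for I z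
  proof -
    have "(Im z * q1 I)\<^sup>2 + (Im z * q2 I)\<^sup>2 + (Im z * q3 I)\<^sup>2 =
        (Im z)\<^sup>2 * ((q1 I)\<^sup>2 + (q2 I)\<^sup>2 + (q3 I)\<^sup>2)"
      by (simp add: algebra_simps)
    then show ?thesis using that unfolding imag_sphere_iff
      by (simp add: dist_norm norm_quat_def inner_quat_def phi_quat of_real_quat minus_quat_def
          cmod_def flip: power2_eq_square)
  qed
  have "symmetric ?B"
    unfolding symmetric_def
  proof (intro allI ballI impI)
    fix \<alpha> \<beta> I K assume "I \<in> imag_sphere" "K \<in> imag_sphere" "of_real \<alpha> + of_real \<beta> * I \<in> ?B"
    then show "of_real \<alpha> + of_real \<beta> * K \<in> ?B"
      using d[of I "Complex \<alpha> \<beta>"] d[of K "Complex \<alpha> \<beta>"] by (simp add: phi_def)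
  qed
  moreover have "speared_open ?B"
    unfolding speared_open_def
  proof (intro conjI ballI)
    fix I C assume "I \<in> imag_sphere" and C: "C \<in> components (half_slice ?B I)"
    have x: "of_real x \<in> half_slice ?B I"
      using r(1) by (auto simp: half_slice_eq intro!: image_eqI[of _ _ "of_real x"])
    have "convex {z. Im z \<ge> 0}" by (rule convex_halfspace_Im_ge)
    then have "convex (half_slice ?B I)"
      unfolding half_slice_eq
      by (intro convex_Int convex_ball convex_linear_image bounded_linear.linear[OF bounded_linear_phi])
    then have "connected (half_slice ?B I)" by (rule convex_connected)
    then have "components (half_slice ?B I) = {half_slice ?B I}"
      using x by (subst components_eq_sing_iff) blast
    then have "C = half_slice ?B I" using C by blast
    then show "C \<inter> \<real> \<noteq> {}" using x by auto
  qed simp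
  ultimately have "?B \<subseteq> core \<Omega>" using core_largest(4) r(2) by blast
  then show ?thesis using r(1) by auto
qed

text \<open>The real axis is thus crossed only inside the core, which lets a tube around a path to
  the axis differ from the core on one side only.\<close>

lemma real_mem_core_RC:
  assumes "open \<Omega>" "I \<in> imag_sphere" "phi I z \<in> \<Omega>" "Im z = 0"
  shows "z \<in> core_RC \<Omega>"
proof -
  have z: "z = of_real (Re z)" using assms(4) by (simp add: complex_eq_iff)
  have "phi I z = of_real (Re z)" by (subst z) simp
  then have "phi I z \<in> core \<Omega>" using real_mem_core[OF assms(1)] assms(3) by simp
  then show ?thesis using mem_core_RC_iff[OF assms(2)] by blast
qed


section \<open>Identity principle for stem functions\<close>

text \<open>The pointwise part of \<open>holomorphic_stem_on\<close>, separated from the symmetry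
  under conjugation because the neighbourhoods to be built need not be invariant under it.\<close>

definition stem_differentiable :: "(complex \<Rightarrow> cquat) \<Rightarrow> complex \<Rightarrow> bool"
  where "stem_differentiable F z \<longleftrightarrow>
    (\<exists>w. (F has_derivative (\<lambda>h. cquat_mult (cquat_of_complex h) w)) (at z))"

lemma cquat_mult_of_complex:
  "cquat_mult (cquat_of_complex h) w =
    (Re h *\<^sub>R fst w - Im h *\<^sub>R snd w, Re h *\<^sub>R snd w + Im h *\<^sub>R fst w)"
  by (simp add: cquat_mult_def cquat_of_complex_def of_real_def)

lemma bounded_linear_cquat_cnj: "bounded_linear cquat_cnj"
  unfolding cquat_cnj_def
  by (intro bounded_linear_Pair bounded_linear_minus bounded_linear_fst bounded_linear_snd)

lemma cquat_cnj_cnj [simp]: "cquat_cnj (cquat_cnj w) = w"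
  by (simp add: cquat_cnj_def)

text \<open>Conjugation in the source and conjugation in the target are both antilinear, so the
  composite derivative is again linear over multiplication by \<open>\<i>\<close>.\<close>

lemma stem_differentiable_cnj:
  assumes "stem_differentiable F (cnj z)"
  shows "stem_differentiable (\<lambda>w. cquat_cnj (F (cnj w))) z"
proof -
  obtain w where w: "(F has_derivative (\<lambda>h. cquat_mult (cquat_of_complex h) w)) (at (cnj z))"
    using assms by (auto simp: stem_differentiable_def)
  have "((\<lambda>u. F (cnj u)) has_derivative (\<lambda>h. cquat_mult (cquat_of_complex (cnj h)) w)) (at z)"
    by (rule has_derivative_compose[OF bounded_linear_imp_has_derivative[OF bounded_linear_cnj] w])
  then have "((\<lambda>u. cquat_cnj (F (cnj u))) has_derivative
      (\<lambda>h. cquat_cnj (cquat_mult (cquat_of_complex (cnj h)) w))) (at z)"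
    by (rule bounded_linear.has_derivative[OF bounded_linear_cquat_cnj])
  moreover have "cquat_cnj (cquat_mult (cquat_of_complex (cnj h)) w) =
      cquat_mult (cquat_of_complex h) (cquat_cnj w)" for h
    by (simp add: cquat_mult_of_complex cquat_cnj_def)
  ultimately have "((\<lambda>u. cquat_cnj (F (cnj u))) has_derivative
      (\<lambda>h. cquat_mult (cquat_of_complex h) (cquat_cnj w))) (at z)" by simp
  then show ?thesis unfolding stem_differentiable_def by blast
qed

lemma stem_differentiable_transform:
  assumes "stem_differentiable F z" "open U" "z \<in> U" "\<And>w. w \<in> U \<Longrightarrow> F w = G w"
  shows "stem_differentiable G z"
proof -
  obtain w where "(F has_derivative (\<lambda>h. cquat_mult (cquat_of_complex h) w)) (at z)"
    using assms(1) by (auto simp: stem_differentiable_def)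
  from has_derivative_transform_within_open[OF this assms(2,3,4)]
  show ?thesis unfolding stem_differentiable_def by blast
qed

text \<open>For each \<open>p\<close>, the functional sending \<open>x + \<iota>y\<close> to the complex number with real part
  \<open>x \<bullet> p\<close> and imaginary part \<open>y \<bullet> p\<close> turns multiplication by \<open>\<iota>\<close> into multiplication by \<open>\<i>\<close>,
  which reduces the claim to the identity principle for complex functions.\<close>

lemma stem_identity:
  assumes D: "speared_open_RC D"
    and F: "\<And>z. z \<in> D \<Longrightarrow> stem_differentiable F z"
    and G: "\<And>z. z \<in> D \<Longrightarrow> stem_differentiable G z"
    and eq: "\<And>x. complex_of_real x \<in> D \<Longrightarrow> F (of_real x) = G (of_real x)"
    and z: "z \<in> D"
  shows "F z = G z"
proof -
  let ?l = "\<lambda>p (w::cquat). of_real (inner (fst w) p) + \<i> * of_real (inner (snd w) p) :: complex"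
  have bl: "bounded_linear (?l p)" for p
    by (intro bounded_linear_add bounded_linear_const_mult
        bounded_linear_compose[OF bounded_linear_of_real]
        bounded_linear_compose[OF bounded_linear_inner_left] bounded_linear_fst bounded_linear_snd)
  have hol: "(\<lambda>z. ?l p (H z)) holomorphic_on D"
    if H: "\<And>z. z \<in> D \<Longrightarrow> stem_differentiable H z" for H p
    unfolding holomorphic_on_def
  proof
    fix z assume "z \<in> D"
    then obtain w where "(H has_derivative (\<lambda>h. cquat_mult (cquat_of_complex h) w)) (at z)"
      using H stem_differentiable_def by blast
    then have "((\<lambda>z. ?l p (H z)) has_derivative
        (\<lambda>h. ?l p (cquat_mult (cquat_of_complex h) w))) (at z)"
      by (rule bounded_linear.has_derivative[OF bl])
    moreover have "?l p (cquat_mult (cquat_of_complex h) w) = ?l p w * h" for h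
      by (simp add: cquat_mult_of_complex complex_eq_iff inner_diff_left inner_add_left algebra_simps)
    ultimately have "((\<lambda>z. ?l p (H z)) has_field_derivative ?l p w) (at z)"
      by (simp add: has_field_derivative_def)
    then show "(\<lambda>z. ?l p (H z)) field_differentiable at z within D"
      using field_differentiable_def has_field_derivative_at_within by blast
  qed
  obtain C where "connected C" "C \<subseteq> D" "z \<in> C" "C \<inter> \<real> \<noteq> {}"
    using D z unfolding speared_open_RC_iff by blast
  then obtain x0 where x0: "complex_of_real x0 \<in> connected_component_set D z"
    using connected_component_maximal[of z C D] by (auto elim!: Reals_cases)
  let ?S = "connected_component_set D z"
  have sub: "?S \<subseteq> D" by (rule connected_component_subset)
  have opS: "open ?S" using D by (simp add: speared_open_RC_def open_connected_component)
  let ?R = "{w \<in> ?S. w \<in> \<real>}"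
  \<comment> \<open>The component is open, so it contains a whole real interval about
    \<open>x0\<close>; this supplies the accumulation point that analytic continuation
    requires.\<close>
  have lim: "complex_of_real x0 islimpt ?R"
    unfolding islimpt_approachable
  proof (intro allI impI)
    fix e :: real assume "e > 0"
    obtain r where r: "r > 0" "ball (complex_of_real x0) r \<subseteq> ?S"
      using opS x0 open_contains_ball by blast
    let ?t = "min e r / 2"
    have t: "?t > 0" "?t < e" "?t < r" using r(1) \<open>e > 0\<close> by auto
    have "dist (complex_of_real (x0 + ?t)) (of_real x0) = ?t"
      using t(1) by (simp only: dist_of_real) (simp add: dist_real_def)
    moreover from this have "complex_of_real (x0 + ?t) \<in> ball (of_real x0) r"
      unfolding mem_ball using t(3) by (metis dist_commute)
    with r(2) have "complex_of_real (x0 + ?t) \<in> ?S" by blast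
    moreover have "complex_of_real (x0 + ?t) \<in> \<real>" by (rule Reals_of_real)
    ultimately have "complex_of_real (x0 + ?t) \<in> ?R" "complex_of_real (x0 + ?t) \<noteq> of_real x0"
        "dist (complex_of_real (x0 + ?t)) (of_real x0) < e"
      using t by (blast, force, presburger)
    then show "\<exists>x'\<in>?R. x' \<noteq> of_real x0 \<and> dist x' (of_real x0) < e" by blast
  qed
  have l: "?l p (F z) = ?l p (G z)" for p
  proof -
    have "?l p (F z) - ?l p (G z) = 0"
    proof (rule analytic_continuation[of "\<lambda>z. ?l p (F z) - ?l p (G z)" ?S ?R "of_real x0"])
      show "(\<lambda>z. ?l p (F z) - ?l p (G z)) holomorphic_on ?S"
        by (intro holomorphic_on_diff holomorphic_on_subset[OF hol sub] F G)
      show "?l p (F w) - ?l p (G w) = 0" if "w \<in> ?R" for w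
        using that eq sub by (auto elim!: Reals_cases)
      show "z \<in> ?S" using z by (simp add: connected_component_refl)
    qed (use opS lim x0 in auto)
    then show ?thesis by simp
  qed
  have "inner (fst (F z)) p = inner (fst (G z)) p" "inner (snd (F z)) p = inner (snd (G z)) p" for p
    using l[of p] by (simp_all add: complex_eq_iff)
  then show ?thesis
    using vector_eq_rdot[of "fst (F z)" "fst (G z)"] vector_eq_rdot[of "snd (F z)" "snd (G z)"]
    by (simp add: prod_eq_iff)
qed


section \<open>The double-index family\<close>

lemma F2_formula_of_real:
  assumes "J \<noteq> K"
  shows "F2_formula f J K (of_real x) = (f (of_real x), 0)"
proof -
  have "inverse (J - K) * (J * f (of_real x) - K * f (of_real x)) =
      inverse (J - K) * ((J - K) * f (of_real x))"
    by (simp add: left_diff_distrib)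
  also have "\<dots> = f (of_real x)" using assms by (simp flip: mult.assoc)
  finally show ?thesis by (simp add: F2_formula_def)
qed

text \<open>Multiplying the Cauchy-Riemann equation by \<open>I\<close> from the left expresses the
  derivative along \<open>\<i>\<close> by the one along \<open>1\<close>. The whole derivative is
  then left multiplication of \<open>a\<close> by \<open>phi I h\<close>.\<close>

lemma slice_regular_derivative:
  assumes "slice_regular_on \<Omega> f" "I \<in> imag_sphere" "phi I z \<in> \<Omega>"
  obtains a where "((\<lambda>z. f (phi I z)) has_derivative (\<lambda>h. Re h *\<^sub>R a + Im h *\<^sub>R (I * a))) (at z)"
proof -
  obtain g' :: "complex \<Rightarrow> complex \<Rightarrow>\<^sub>L quat"
    where g': "\<forall>z \<in> phi I -` \<Omega>. ((f \<circ> phi I) has_derivative blinfun_apply (g' z)) (at z) \<and>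
       blinfun_apply (g' z) 1 + I * blinfun_apply (g' z) \<i> = 0"
    using assms(1,2) unfolding slice_regular_on_def by blast
  let ?d = "blinfun_apply (g' z)"
  have d: "((f \<circ> phi I) has_derivative ?d) (at z)" "?d 1 + I * ?d \<i> = 0"
    using g' assms(3) by auto
  have "I * ?d 1 + I * (I * ?d \<i>) = 0" using d(2) by (metis distrib_left mult_zero_right)
  then have i: "?d \<i> = I * ?d 1"
    by (simp add: imag_sphere_square[OF assms(2)] flip: mult.assoc)
  have "?d h = Re h *\<^sub>R ?d 1 + Im h *\<^sub>R (I * ?d 1)" for h
  proof -
    have h: "h = Re h *\<^sub>R 1 + Im h *\<^sub>R \<i>" by (simp add: complex_eq_iff)
    show ?thesis
      by (subst h) (simp only: blinfun.add_right blinfun.scaleR_right i)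
  qed
  then have "?d = (\<lambda>h. Re h *\<^sub>R ?d 1 + Im h *\<^sub>R (I * ?d 1))" by (rule ext)
  from has_derivative_eq_rhs[OF d(1) this] have "((\<lambda>z. f (phi I z)) has_derivative
      (\<lambda>h. Re h *\<^sub>R ?d 1 + Im h *\<^sub>R (I * ?d 1))) (at z)"
    unfolding o_def .
  then show ?thesis by (rule that)
qed

lemma stem_differentiable_F2_formula:
  assumes f: "slice_regular_on \<Omega> f" and J: "J \<in> imag_sphere" and K: "K \<in> imag_sphere"
    and z: "phi J z \<in> \<Omega>" "phi K z \<in> \<Omega>"
  shows "stem_differentiable (F2_formula f J K) z"
proof -
  obtain a where a:
    "((\<lambda>z. f (phi J z)) has_derivative (\<lambda>h. Re h *\<^sub>R a + Im h *\<^sub>R (J * a))) (at z)"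
    using slice_regular_derivative[OF f J z(1)] .
  obtain b where b:
    "((\<lambda>z. f (phi K z)) has_derivative (\<lambda>h. Re h *\<^sub>R b + Im h *\<^sub>R (K * b))) (at z)"
    using slice_regular_derivative[OF f K z(2)] .
  let ?c = "inverse (J - K)"
  \<comment> \<open>The formula itself with the values of \<open>f\<close> replaced by the
    derivatives \<open>a\<close> and \<open>b\<close>. Since \<open>J * J = K * K = -1\<close>, the
    imaginary part of \<open>h\<close> exchanges the two components with the sign of multiplication
    by \<open>\<iota>\<close>.\<close>
  let ?w = "(?c * (J * a - K * b), ?c * (a - b))"
  have "(F2_formula f J K has_derivative
      (\<lambda>h. (?c * (J * (Re h *\<^sub>R a + Im h *\<^sub>R (J * a)) - K * (Re h *\<^sub>R b + Im h *\<^sub>R (K * b))),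
        ?c * ((Re h *\<^sub>R a + Im h *\<^sub>R (J * a)) - (Re h *\<^sub>R b + Im h *\<^sub>R (K * b)))))) (at z)"
    unfolding F2_formula_def
    by (intro has_derivative_Pair has_derivative_mult_right has_derivative_diff a b)
  moreover have "(\<lambda>h. (?c * (J * (Re h *\<^sub>R a + Im h *\<^sub>R (J * a)) - K * (Re h *\<^sub>R b + Im h *\<^sub>R (K * b))),
        ?c * ((Re h *\<^sub>R a + Im h *\<^sub>R (J * a)) - (Re h *\<^sub>R b + Im h *\<^sub>R (K * b))))) =
      (\<lambda>h. cquat_mult (cquat_of_complex h) ?w)"
  proof
    fix h
    have "J * (Im h *\<^sub>R (J * a)) = - (Im h *\<^sub>R a)" "K * (Im h *\<^sub>R (K * b)) = - (Im h *\<^sub>R b)"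
      using imag_sphere_square J K by (simp_all flip: mult.assoc)
    then show "(?c * (J * (Re h *\<^sub>R a + Im h *\<^sub>R (J * a)) - K * (Re h *\<^sub>R b + Im h *\<^sub>R (K * b))),
        ?c * ((Re h *\<^sub>R a + Im h *\<^sub>R (J * a)) - (Re h *\<^sub>R b + Im h *\<^sub>R (K * b)))) =
      cquat_mult (cquat_of_complex h) ?w"
      by (simp add: cquat_mult_of_complex algebra_simps)
  qed
  ultimately have "(F2_formula f J K has_derivative (\<lambda>h. cquat_mult (cquat_of_complex h) ?w)) (at z)"
    by (simp only:)
  then show ?thesis unfolding stem_differentiable_def by blast
qed

text \<open>Stated for the bare formula, which is holomorphic wherever both indices map into
  \<open>\<Omega>\<close>, whatever the sign of the imaginary part; \<open>D\<close> may therefore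
  extend across the real axis.\<close>

lemma F2_formula_independent:
  assumes "slice_regular_on \<Omega> f" "speared_open_RC D" "z \<in> D"
    and "\<And>I w. I \<in> {J, K, J', K'} \<Longrightarrow> w \<in> D \<Longrightarrow> I \<in> imag_sphere \<and> phi I w \<in> \<Omega>"
    and "J \<noteq> K" "J' \<noteq> K'"
  shows "F2_formula f J K z = F2_formula f J' K' z"
proof (rule stem_identity[OF assms(2) _ _ _ assms(3)])
  fix w assume "w \<in> D"
  then show "stem_differentiable (F2_formula f J K) w" "stem_differentiable (F2_formula f J' K') w"
    using assms(4) by (intro stem_differentiable_F2_formula[OF assms(1)]; simp)+
qed (use assms(5,6) in \<open>simp_all add: F2_formula_of_real\<close>)

text \<open>At real points the value has second component 0 and is fixed by conjugation, so the
  identity principle applies to the formula and its reflection. This reconciles the two branches of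
  \<open>F2\<close> on the core.\<close>

lemma F2_formula_cnj:
  assumes "slice_regular_on \<Omega> f" and D: "speared_open_RC D" "cnj ` D = D" and z: "z \<in> D"
    and D\<Omega>: "\<And>I w. I \<in> {J, K} \<Longrightarrow> w \<in> D \<Longrightarrow> I \<in> imag_sphere \<and> phi I w \<in> \<Omega>"
    and "J \<noteq> K"
  shows "cquat_cnj (F2_formula f J K (cnj z)) = F2_formula f J K z"
proof (rule stem_identity[OF D(1) _ _ _ z])
  fix w assume w: "w \<in> D"
  then have "cnj w \<in> D" using D(2) by (metis mem_image_cnj_iff)
  then show "stem_differentiable (\<lambda>z. cquat_cnj (F2_formula f J K (cnj z))) w"
    using D\<Omega> by (intro stem_differentiable_cnj stem_differentiable_F2_formula[OF assms(1)]) simp_all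
  show "stem_differentiable (F2_formula f J K) w"
    using w D\<Omega> by (intro stem_differentiable_F2_formula[OF assms(1)]) simp_all
qed (use \<open>J \<noteq> K\<close> in \<open>simp_all add: F2_formula_of_real cquat_cnj_def\<close>)

lemma F2_cnj:
  assumes JK: "J \<in> imag_sphere" "K \<in> imag_sphere" "J \<noteq> K" and z: "z \<in> D2 \<Omega> J K"
  shows "F2 \<Omega> f J K (cnj z) = cquat_cnj (F2 \<Omega> f J K z)"
proof (cases "z \<in> E2 \<Omega> J K \<and> cnj z \<in> E2 \<Omega> J K")
  case True
  \<comment> \<open>Only at real points is the formula branch taken for both \<open>z\<close> and
    \<open>cnj z\<close>. Otherwise exactly one of them lies in \<open>E2\<close>, and the claim is
    the definition of \<open>F2\<close>.\<close>
  then have "Im z = 0" using JK by (simp add: mem_E2_iff)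
  then have "z = of_real (Re z)" by (simp add: complex_eq_iff)
  then have "cnj z = of_real (Re z)" "z = of_real (Re z)" by (simp_all add: complex_eq_iff)
  then have "F2_formula f J K (cnj z) = (f (of_real (Re z)), 0)"
      "F2_formula f J K z = (f (of_real (Re z)), 0)"
    using F2_formula_of_real[OF JK(3)] by metis+
  then show ?thesis using True by (simp add: F2_def cquat_cnj_def)
next
  case False
  then show ?thesis using z by (auto simp: F2_def mem_D2_iff)
qed


section \<open>Neighbourhoods on which the family is constant\<close>

lemma upper_nbhd:
  assumes \<Omega>: "open \<Omega>" "speared_open \<Omega>" and J: "J \<in> imag_sphere"
    and z: "Im z > 0" "phi J z \<in> \<Omega>"
  obtains \<epsilon> U where "\<epsilon> > 0" "speared_open_RC U" "z \<in> U" "core_RC \<Omega> \<subseteq> U"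
    "U - core_RC \<Omega> \<subseteq> {w. Im w > 0}"
    "\<And>I w. I \<in> Cap J \<epsilon> \<Longrightarrow> w \<in> U \<Longrightarrow> phi I w \<in> \<Omega>"
proof -
  \<comment> \<open>The closed upper half of the slice is not open in the plane. Adding the core
    makes it so, because the core is open and contains the real points; in an open set connectedness
    yields a path.\<close>
  let ?A = "core_RC \<Omega> \<union> ({w. Im w > 0} \<inter> phi J -` \<Omega>)"
  have opA: "open ?A"
    by (rule open_Un[OF open_core_RC
          open_Int[OF open_halfspace_Im_gt open_vimage[OF \<Omega>(1) continuous_on_phi]]])
  have "Im z \<ge> 0" using z(1) by simp
  then obtain C where C: "connected C" "C \<subseteq> {w. Im w \<ge> 0 \<and> phi J w \<in> \<Omega>}" "z \<in> C" "C \<inter> \<real> \<noteq> {}"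
    using upper_half_slice_reaches_real[OF \<Omega>(2) J _ z(2)] by metis
  then obtain x where x: "x \<in> C" "x \<in> \<real>" by blast
  have "C \<subseteq> ?A"
  proof
    fix w assume "w \<in> C"
    then have "Im w \<ge> 0" "phi J w \<in> \<Omega>" using C(2) by auto
    then show "w \<in> ?A" using real_mem_core_RC[OF \<Omega>(1) J, of w] by (cases "Im w = 0") auto
  qed
  then have "connected_component ?A z x" using C x unfolding connected_component_def by blast
  then have "path_component ?A z x" using open_path_connected_component[OF opA] by simp
  then obtain g where g: "path g" "path_image g \<subseteq> ?A" "pathstart g = z" "pathfinish g = x"
    unfolding path_component_def by blast
  let ?P = "path_image g"
  \<comment> \<open>Points and indices are varied together: one compactness argument in the product
    space gives both the width of the tube and the radius of the cap.\<close>
  let ?O = "?A \<times> UNIV \<inter> (\<lambda>p. phi (snd p) (fst p)) -` \<Omega>"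
  have "continuous_on UNIV (\<lambda>p. phi (snd p) (fst p))"
    unfolding phi_def by (intro continuous_intros)
  then have opO: "open ?O"
    by (rule open_Int[OF open_Times[OF opA open_UNIV] open_vimage[OF \<Omega>(1)]])
  have "compact (?P \<times> {J})" using g(1) by (intro compact_Times compact_path_image) auto
  moreover have "?P \<times> {J} \<subseteq> ?O" using g(2) phi_core_RC[OF _ J] by auto
  ultimately obtain e where e: "e > 0" "(\<Union>p\<in>?P \<times> {J}. ball p e) \<subseteq> ?O"
    by (rule compact_subset_open_imp_ball_epsilon_subset[OF _ opO])
  \<comment> \<open>The product distance is at most the sum of the two distances, so
    \<open>e\<close> is split evenly between point and index.\<close>
  let ?N = "\<Union>p\<in>?P. ball p (e/2)"
  have tube: "(w, I) \<in> ?O" if "w \<in> ?N" "norm (I - J) < e/2" for w I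
  proof -
    from that(1) obtain p where p: "p \<in> ?P" "dist p w < e/2" by auto
    have "dist (p, J) (w, I) \<le> dist p w + dist J I"
      unfolding dist_Pair_Pair by (rule sqrt_sum_squares_le_sum) simp_all
    also have "\<dots> < e" using p(2) that(2) by (simp add: dist_norm norm_minus_commute)
    finally have "(w, I) \<in> ball (p, J) e" by simp
    moreover have "(p, J) \<in> ?P \<times> {J}" using p(1) by simp
    ultimately show ?thesis using e(2) by blast
  qed
  have NA: "?N \<subseteq> ?A"
  proof
    fix w assume "w \<in> ?N"
    then have "(w, J) \<in> ?O" using e(1) by (intro tube) simp_all
    then show "w \<in> ?A" by blast
  qed
  have P: "?P \<subseteq> ?N" using e(1) by auto
  have "speared_open_RC ?N"
    unfolding speared_open_RC_iff
  proof (intro conjI ballI)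
    fix w assume "w \<in> ?N"
    then obtain p where p: "p \<in> ?P" "w \<in> ball p (e/2)" by blast
    \<comment> \<open>Each point of the tube is joined to the real endpoint \<open>x\<close> through
      its ball and then along the path.\<close>
    have "connected (?P \<union> ball p (e/2))"
      using p e(1) by (intro connected_Un connected_path_image g connected_ball) auto
    moreover have "?P \<union> ball p (e/2) \<subseteq> ?N" using p(1) P by blast
    moreover have "x \<in> ?P" using g(4) pathfinish_in_path_image by blast
    ultimately show "\<exists>C. connected C \<and> C \<subseteq> ?N \<and> w \<in> C \<and> C \<inter> \<real> \<noteq> {}"
      using p(2) x(2) by (intro exI[of _ "?P \<union> ball p (e/2)"]) blast
  qed auto
  then have "speared_open_RC (\<Union>{core_RC \<Omega>, ?N})"
    using speared_core_RC by (intro speared_open_RC_Union) blast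
  then have "speared_open_RC (core_RC \<Omega> \<union> ?N)" by simp
  moreover have "z \<in> core_RC \<Omega> \<union> ?N" using g(3) P pathstart_in_path_image by blast
  moreover have "(core_RC \<Omega> \<union> ?N) - core_RC \<Omega> \<subseteq> {w. Im w > 0}" using NA by blast
  moreover have "phi I w \<in> \<Omega>" if "I \<in> Cap J (e/2)" "w \<in> core_RC \<Omega> \<union> ?N" for I w
    using that(2)
  proof
    assume "w \<in> core_RC \<Omega>"
    then show ?thesis using that(1) by (simp add: Cap_def phi_core_RC)
  next
    assume "w \<in> ?N"
    then show ?thesis using tube[of w I] that(1) by (simp add: Cap_def)
  qed
  moreover have "e/2 > 0" using e(1) by simp
  ultimately show ?thesis using that[of "e/2" "core_RC \<Omega> \<union> ?N"] by blast
qed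

text \<open>Agreement is expressed among the members of the family, with no reference to a limit
  function, so such neighbourhoods can be found before that function is defined. Allowing either
  half-plane makes the notion invariant under conjugation.\<close>

definition stable_nbhd :: "quat set \<Rightarrow> (quat \<Rightarrow> quat) \<Rightarrow> quat \<Rightarrow> real \<Rightarrow> complex set \<Rightarrow> bool"
  where "stable_nbhd \<Omega> f J \<epsilon> U \<longleftrightarrow> \<epsilon> > 0 \<and> speared_open_RC U \<and> core_RC \<Omega> \<subseteq> U \<and>
    (U - core_RC \<Omega> \<subseteq> {w. Im w > 0} \<or> U - core_RC \<Omega> \<subseteq> {w. Im w < 0}) \<and>
    (\<forall>J'\<in>Cap J \<epsilon>. \<forall>K'\<in>Cap J \<epsilon>. J' \<noteq> K' \<longrightarrow>
      (\<forall>w\<in>U. w \<in> D2 \<Omega> J' K' \<and> stem_differentiable (F2 \<Omega> f J' K') w \<and>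
        (\<forall>J''\<in>Cap J \<epsilon>. \<forall>K''\<in>Cap J \<epsilon>. J'' \<noteq> K'' \<longrightarrow> F2 \<Omega> f J' K' w = F2 \<Omega> f J'' K'' w)))"

text \<open>On all of \<open>U\<close> the function \<open>F2\<close> equals its formula: a point of
  \<open>U\<close> below the axis lies in the core, where the two branches agree. Holomorphy and
  independence of the indices are then inherited from the formula.\<close>

lemma stable_nbhd_upper:
  assumes f: "slice_regular_on \<Omega> f" and J: "J \<in> imag_sphere"
    and \<epsilon>: "\<epsilon> > 0" and U: "speared_open_RC U" "core_RC \<Omega> \<subseteq> U" "U - core_RC \<Omega> \<subseteq> {w. Im w > 0}"
    and U\<Omega>: "\<And>I w. I \<in> Cap J \<epsilon> \<Longrightarrow> w \<in> U \<Longrightarrow> phi I w \<in> \<Omega>"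
  shows "stable_nbhd \<Omega> f J \<epsilon> U"
proof -
  have S: "I \<in> imag_sphere" if "I \<in> Cap J \<epsilon>" for I using that by (simp add: Cap_def)
  have D2: "w \<in> D2 \<Omega> J' K'" if "J' \<in> Cap J \<epsilon>" "K' \<in> Cap J \<epsilon>" "w \<in> U" for J' K' w
  proof (cases "Im w \<ge> 0")
    case True
    then show ?thesis using that U\<Omega> S by (simp add: mem_D2_iff mem_E2_iff)
  next
    case False
    then have "w \<in> core_RC \<Omega>" using U(3) that(3) by force
    then have "cnj w \<in> core_RC \<Omega>" by (simp add: cnj_core_RC_iff)
    then show ?thesis using False S that(1,2) by (simp add: mem_D2_iff mem_E2_iff phi_core_RC)
  qed
  have F2: "F2 \<Omega> f J' K' w = F2_formula f J' K' w"
    if JK: "J' \<in> Cap J \<epsilon>" "K' \<in> Cap J \<epsilon>" "J' \<noteq> K'" and w: "w \<in> U" for J' K' w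
  proof (cases "w \<in> E2 \<Omega> J' K'")
    case False
    then have "Im w < 0" using JK w U\<Omega> S by (auto simp: mem_E2_iff)
    then have "w \<in> core_RC \<Omega>" using U(3) w by force
    then have "cquat_cnj (F2_formula f J' K' (cnj w)) = F2_formula f J' K' w"
      using JK S phi_core_RC
      by (intro F2_formula_cnj[OF f speared_core_RC cnj_image_core_RC]) auto
    then show ?thesis using False by (simp add: F2_def)
  qed (simp add: F2_def)
  have "stem_differentiable (F2 \<Omega> f J' K') w"
    if JK: "J' \<in> Cap J \<epsilon>" "K' \<in> Cap J \<epsilon>" "J' \<noteq> K'" and w: "w \<in> U" for J' K' w
  proof (rule stem_differentiable_transform)
    show "stem_differentiable (F2_formula f J' K') w"
      using JK w S U\<Omega> by (intro stem_differentiable_F2_formula[OF f])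
    show "open U" using U(1) by (simp add: speared_open_RC_def)
    show "F2_formula f J' K' v = F2 \<Omega> f J' K' v" if "v \<in> U" for v using F2 JK that by simp
  qed (rule w)
  moreover have "F2 \<Omega> f J' K' w = F2 \<Omega> f J'' K'' w"
    if "J' \<in> Cap J \<epsilon>" "K' \<in> Cap J \<epsilon>" "J' \<noteq> K'" "w \<in> U"
      "J'' \<in> Cap J \<epsilon>" "K'' \<in> Cap J \<epsilon>" "J'' \<noteq> K''" for J' K' J'' K'' w
    using F2_formula_independent[OF f U(1) that(4), of J' K' J'' K''] that S U\<Omega> F2 by auto
  ultimately show ?thesis unfolding stable_nbhd_def using \<epsilon> U D2 by blast
qed

text \<open>Every \<open>F2\<close> commutes with conjugation on its own domain, so agreement and
  holomorphy at \<open>cnj w\<close> carry over to \<open>w\<close> with the same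
  \<open>\<epsilon>\<close>.\<close>

lemma stable_nbhd_cnj:
  assumes U: "stable_nbhd \<Omega> f J \<epsilon> U"
  shows "stable_nbhd \<Omega> f J \<epsilon> (cnj ` U)"
proof -
  have S: "I \<in> imag_sphere" if "I \<in> Cap J \<epsilon>" for I using that by (simp add: Cap_def)
  have opU: "open (cnj ` U)" using U by (simp add: stable_nbhd_def speared_open_RC_def open_image_cnj)
  have D2: "cnj w \<in> D2 \<Omega> J' K'" "w \<in> D2 \<Omega> J' K'"
    if "J' \<in> Cap J \<epsilon>" "K' \<in> Cap J \<epsilon>" "J' \<noteq> K'" "w \<in> cnj ` U" for J' K' w
  proof -
    show "cnj w \<in> D2 \<Omega> J' K'" using U that unfolding stable_nbhd_def mem_image_cnj_iff by blast
    then show "w \<in> D2 \<Omega> J' K'" by (auto simp: mem_D2_iff)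
  qed
  have F2: "F2 \<Omega> f J' K' w = cquat_cnj (F2 \<Omega> f J' K' (cnj w))"
    if "J' \<in> Cap J \<epsilon>" "K' \<in> Cap J \<epsilon>" "J' \<noteq> K'" "w \<in> cnj ` U" for J' K' w
    using F2_cnj[OF S S that(3) D2(1), of w] that by simp
  have diff: "stem_differentiable (F2 \<Omega> f J' K') w"
    if JK: "J' \<in> Cap J \<epsilon>" "K' \<in> Cap J \<epsilon>" "J' \<noteq> K'" and w: "w \<in> cnj ` U" for J' K' w
  proof (rule stem_differentiable_transform[OF _ opU w])
    have "stem_differentiable (F2 \<Omega> f J' K') (cnj w)"
      using U JK w unfolding stable_nbhd_def mem_image_cnj_iff by blast
    then show "stem_differentiable (\<lambda>w. cquat_cnj (F2 \<Omega> f J' K' (cnj w))) w"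
      by (rule stem_differentiable_cnj)
    show "cquat_cnj (F2 \<Omega> f J' K' (cnj v)) = F2 \<Omega> f J' K' v" if "v \<in> cnj ` U" for v
      using F2[OF JK that] by simp
  qed
  have indep: "F2 \<Omega> f J' K' w = F2 \<Omega> f J'' K'' w"
    if *: "J' \<in> Cap J \<epsilon>" "K' \<in> Cap J \<epsilon>" "J' \<noteq> K'" "w \<in> cnj ` U"
      "J'' \<in> Cap J \<epsilon>" "K'' \<in> Cap J \<epsilon>" "J'' \<noteq> K''" for J' K' J'' K'' w
  proof -
    have "F2 \<Omega> f J' K' (cnj w) = F2 \<Omega> f J'' K'' (cnj w)"
      using U * unfolding stable_nbhd_def mem_image_cnj_iff by blast
    then show ?thesis using F2 * by metis
  qed
  have sub: "cnj ` U - core_RC \<Omega> \<subseteq> cnj ` (U - core_RC \<Omega>)"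
    by (auto simp: mem_image_cnj_iff cnj_core_RC_iff)
  have "U - core_RC \<Omega> \<subseteq> {w. Im w > 0} \<or> U - core_RC \<Omega> \<subseteq> {w. Im w < 0}"
    using U unfolding stable_nbhd_def by blast
  then have half: "cnj ` U - core_RC \<Omega> \<subseteq> {w. Im w > 0} \<or> cnj ` U - core_RC \<Omega> \<subseteq> {w. Im w < 0}"
  proof
    assume "U - core_RC \<Omega> \<subseteq> {w. Im w > 0}"
    then have "cnj ` (U - core_RC \<Omega>) \<subseteq> {w. Im w < 0}" by auto
    with sub show ?thesis by blast
  next
    assume "U - core_RC \<Omega> \<subseteq> {w. Im w < 0}"
    then have "cnj ` (U - core_RC \<Omega>) \<subseteq> {w. Im w > 0}" by auto
    with sub show ?thesis by blast
  qed
  have "core_RC \<Omega> \<subseteq> U" using U by (simp add: stable_nbhd_def)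
  then have "cnj ` core_RC \<Omega> \<subseteq> cnj ` U" by (rule image_mono)
  then have core: "core_RC \<Omega> \<subseteq> cnj ` U" by (simp only: cnj_image_core_RC)
  have "\<epsilon> > 0" "speared_open_RC (cnj ` U)"
    using U by (simp_all add: stable_nbhd_def speared_open_RC_cnj)
  note this core half D2(2) diff indep
  then show ?thesis unfolding stable_nbhd_def by (intro conjI ballI impI)
qed

lemma stable_nbhd_core:
  assumes "slice_regular_on \<Omega> f" "J \<in> imag_sphere"
  shows "stable_nbhd \<Omega> f J 3 (core_RC \<Omega>)"
  using assms by (intro stable_nbhd_upper speared_core_RC phi_core_RC) (auto simp: Cap_def)

lemma stable_nbhd_exists:
  assumes \<Omega>: "open \<Omega>" "speared_open \<Omega>" and f: "slice_regular_on \<Omega> f" and J: "J \<in> imag_sphere"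
    and z: "z \<in> D1 \<Omega> J"
  obtains \<epsilon> U where "stable_nbhd \<Omega> f J \<epsilon> U" "z \<in> U"
    "z \<in> core_RC \<Omega> \<longrightarrow> U = core_RC \<Omega> \<and> \<epsilon> = 3"
proof -
  have upper: "\<exists>\<epsilon> U. stable_nbhd \<Omega> f J \<epsilon> U \<and> w \<in> U" if w: "Im w > 0" "phi J w \<in> \<Omega>" for w
  proof -
    obtain \<epsilon> U where "\<epsilon> > 0" "speared_open_RC U" "w \<in> U" "core_RC \<Omega> \<subseteq> U"
      "U - core_RC \<Omega> \<subseteq> {w. Im w > 0}" "\<And>I w. I \<in> Cap J \<epsilon> \<Longrightarrow> w \<in> U \<Longrightarrow> phi I w \<in> \<Omega>"
      using upper_nbhd[OF \<Omega> J w] by metis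
    then show ?thesis using stable_nbhd_upper[OF f J] by blast
  qed
  consider "z \<in> core_RC \<Omega>" | "z \<notin> core_RC \<Omega>" "Im z > 0" | "z \<notin> core_RC \<Omega>" "Im z < 0"
    | "z \<notin> core_RC \<Omega>" "Im z = 0" by linarith
  then show ?thesis
  proof cases
    case 1
    then show ?thesis using stable_nbhd_core[OF f J] that by blast
  next
    case 2
    then have "phi J z \<in> \<Omega>" using z J by (simp add: mem_D1_iff)
    then show ?thesis using 2 upper that by blast
  next
    case 3
    then have "phi J (cnj z) \<in> \<Omega>" "Im (cnj z) > 0" using z J by (simp_all add: mem_D1_iff)
    then obtain \<epsilon> U where U: "stable_nbhd \<Omega> f J \<epsilon> U" "cnj z \<in> U" using upper by blast
    from U(2) have "z \<in> cnj ` U" by (simp add: mem_image_cnj_iff)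
    then show ?thesis using that[OF stable_nbhd_cnj[OF U(1)]] 3(1) by blast
  next
    case 4
    \<comment> \<open>This case is contradictory: a real point of \<open>D1 \<Omega> J\<close> is a
      real point of \<open>\<Omega>\<close> and hence belongs to the core.\<close>
    then have "cnj z = z" by (simp add: complex_eq_iff)
    then have "phi J z \<in> \<Omega>" using z J by (auto simp: mem_D1_iff)
    then show ?thesis using real_mem_core_RC[OF \<Omega>(1) J] 4 by blast
  qed
qed

section \<open>Gluing the local values into one stem function\<close>

lemma stable_nbhd_subset_D1:
  assumes "stable_nbhd \<Omega> f J \<epsilon> U" and J: "J \<in> imag_sphere"
  shows "U \<subseteq> D1 \<Omega> J"
proof
  fix w assume w: "w \<in> U"
  have \<epsilon>: "\<epsilon> > 0" using assms(1) by (simp add: stable_nbhd_def)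
  \<comment> \<open>Taking \<open>J\<close> itself as one of the two indices forces the domain of
    the pair into \<open>D1 \<Omega> J\<close>.\<close>
  obtain K where K: "K \<in> Cap J \<epsilon>" "K \<noteq> J" using Cap_other[OF J \<epsilon>] .
  then have "w \<in> D2 \<Omega> K J" using Cap_self[OF J \<epsilon>] assms(1) w unfolding stable_nbhd_def by blast
  then show "w \<in> D1 \<Omega> J" using J K(1) by (auto simp: mem_D2_iff mem_E2_iff mem_D1_iff Cap_def)
qed

text \<open>The value on which the family settles as both indices approach \<open>J\<close>. Binding
  the cap inside the choice keeps it independent of any particular neighbourhood, so the local
  values glue automatically.\<close>

definition F1 :: "quat set \<Rightarrow> (quat \<Rightarrow> quat) \<Rightarrow> quat \<Rightarrow> complex \<Rightarrow> cquat"
  where "F1 \<Omega> f J w = (SOME v. \<exists>\<epsilon>>0. \<forall>J'\<in>Cap J \<epsilon>. \<forall>K'\<in>Cap J \<epsilon>. J' \<noteq> K' \<longrightarrow> F2 \<Omega> f J' K' w = v)"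

lemma F1_eq:
  assumes U: "stable_nbhd \<Omega> f J \<epsilon> U" and J: "J \<in> imag_sphere" and w: "w \<in> U"
    and JK: "J' \<in> Cap J \<epsilon>" "K' \<in> Cap J \<epsilon>" "J' \<noteq> K'"
  shows "F2 \<Omega> f J' K' w = F1 \<Omega> f J w"
proof -
  let ?Q = "\<lambda>v. \<exists>\<epsilon>>0. \<forall>J'\<in>Cap J \<epsilon>. \<forall>K'\<in>Cap J \<epsilon>. J' \<noteq> K' \<longrightarrow> F2 \<Omega> f J' K' w = v"
  have const: "\<forall>J''\<in>Cap J \<epsilon>. \<forall>K''\<in>Cap J \<epsilon>. J'' \<noteq> K'' \<longrightarrow> F2 \<Omega> f J'' K'' w = F2 \<Omega> f J' K' w"
    using U w JK unfolding stable_nbhd_def by metis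
  have \<epsilon>: "\<epsilon> > 0" using U by (simp add: stable_nbhd_def)
  with const have "?Q (F2 \<Omega> f J' K' w)" by blast
  then have "?Q (F1 \<Omega> f J w)" unfolding F1_def by (rule someI)
  then obtain \<delta> where \<delta>: "\<delta> > 0"
    "\<forall>J'\<in>Cap J \<delta>. \<forall>K'\<in>Cap J \<delta>. J' \<noteq> K' \<longrightarrow> F2 \<Omega> f J' K' w = F1 \<Omega> f J w" by blast
  \<comment> \<open>The chosen value may be witnessed by a different cap. The pair \<open>K\<close>,
    \<open>J\<close> lies in both caps and links that value to the one given by
    \<open>U\<close>.\<close>
  obtain K where K: "K \<in> Cap J (min \<delta> \<epsilon>)" "K \<noteq> J" using Cap_other[OF J, of "min \<delta> \<epsilon>"] \<delta>(1) \<epsilon> by auto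
  then have "K \<in> Cap J \<delta>" "K \<in> Cap J \<epsilon>" by (simp_all add: Cap_def)
  then have "F2 \<Omega> f K J w = F2 \<Omega> f J' K' w" "F2 \<Omega> f K J w = F1 \<Omega> f J w"
    using const \<delta>(2) K(2) Cap_self[OF J] \<epsilon> \<delta>(1) by blast+
  then show ?thesis by simp
qed

theorem theorem4p8:
  fixes \<Omega> :: "quat set" and f :: "quat \<Rightarrow> quat" and J :: quat
  assumes "quat_domain \<Omega>" and "speared_open \<Omega>"
    and "slice_regular_on \<Omega> f"
    and "J \<in> imag_sphere"
  shows "speared_open_RC (D1 \<Omega> J) \<and>
    (\<exists>F :: complex \<Rightarrow> cquat. holomorphic_stem_on (D1 \<Omega> J) F \<and>
      (\<forall>z \<in> D1 \<Omega> J. \<exists>\<epsilon>::real. \<exists>U :: complex set.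
         \<epsilon> > 0 \<and> speared_open_RC U \<and> z \<in> U \<and> U \<subseteq> D1 \<Omega> J \<and>
         core_RC \<Omega> \<subseteq> U \<and>
         (U - core_RC \<Omega> \<subseteq> {w. Im w > 0} \<or> U - core_RC \<Omega> \<subseteq> {w. Im w < 0}) \<and>
         (\<forall>J' \<in> Cap J \<epsilon>. \<forall>K' \<in> Cap J \<epsilon>. J' \<noteq> K' \<longrightarrow>
            U \<subseteq> D2 \<Omega> J' K' \<and> (\<forall>w\<in>U. F2 \<Omega> f J' K' w = F w)) \<and>
         (z \<in> core_RC \<Omega> \<longrightarrow> U = core_RC \<Omega> \<and> \<epsilon> = 3 \<and> Cap J \<epsilon> = imag_sphere)))"
proof (intro conjI exI[of _ "F1 \<Omega> f J"] ballI)
  have op: "open \<Omega>" using assms(1) by (simp add: quat_domain_def)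
  note J = assms(4)
  note ex = stable_nbhd_exists[OF op assms(2,3) J]
  \<comment> \<open>Stable neighbourhoods are speared and exhaust \<open>D1 \<Omega> J\<close>, so
    its spearedness is a case of stability under unions.\<close>
  have "D1 \<Omega> J = \<Union>{U. \<exists>\<epsilon>. stable_nbhd \<Omega> f J \<epsilon> U}"
  proof (intro equalityI subsetI)
    fix z assume "z \<in> D1 \<Omega> J"
    then obtain \<epsilon> U where "stable_nbhd \<Omega> f J \<epsilon> U" "z \<in> U" using ex by metis
    then show "z \<in> \<Union>{U. \<exists>\<epsilon>. stable_nbhd \<Omega> f J \<epsilon> U}" by blast
  qed (use stable_nbhd_subset_D1[OF _ J] in blast)
  moreover have "speared_open_RC (\<Union>{U. \<exists>\<epsilon>. stable_nbhd \<Omega> f J \<epsilon> U})"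
    by (intro speared_open_RC_Union) (auto simp: stable_nbhd_def)
  ultimately show sp: "speared_open_RC (D1 \<Omega> J)" by simp
  show "holomorphic_stem_on (D1 \<Omega> J) (F1 \<Omega> f J)"
    unfolding holomorphic_stem_on_def stem_function_on_def stem_differentiable_def[symmetric]
  proof (intro conjI ballI)
    show "open (D1 \<Omega> J)" using sp by (simp add: speared_open_RC_def)
    show "cnj ` D1 \<Omega> J = D1 \<Omega> J" by (auto simp: mem_image_cnj_iff cnj_D1_iff)
    fix z assume "z \<in> D1 \<Omega> J"
    then obtain \<epsilon> U where U: "stable_nbhd \<Omega> f J \<epsilon> U" "z \<in> U" using ex by metis
    have \<epsilon>: "\<epsilon> > 0" using U(1) by (simp add: stable_nbhd_def)
    obtain K where K: "K \<in> Cap J \<epsilon>" "K \<noteq> J" using Cap_other[OF J \<epsilon>] .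
    note KJ = K(1) Cap_self[OF J \<epsilon>] K(2)
    have KS: "K \<in> imag_sphere" using K(1) by (simp add: Cap_def)
    have D2: "z \<in> D2 \<Omega> K J" and diff: "stem_differentiable (F2 \<Omega> f K J) z"
      using U KJ unfolding stable_nbhd_def by blast+
    \<comment> \<open>The reflected neighbourhood is stable with the same \<open>\<epsilon>\<close>,
      so the one pair \<open>K\<close>, \<open>J\<close> computes the function at \<open>z\<close>
      and at \<open>cnj z\<close>.\<close>
    have "F1 \<Omega> f J (cnj z) = F2 \<Omega> f K J (cnj z)"
      using F1_eq[OF stable_nbhd_cnj[OF U(1)] J _ KJ] U(2) by simp
    also have "\<dots> = cquat_cnj (F1 \<Omega> f J z)"
      using F2_cnj[OF KS J K(2) D2] F1_eq[OF U(1) J U(2) KJ] by simp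
    finally show "F1 \<Omega> f J (cnj z) = cquat_cnj (F1 \<Omega> f J z)" .
    \<comment> \<open>Near \<open>z\<close> the glued function coincides with the single member of
      the family for \<open>K\<close>, \<open>J\<close> and takes over its derivative.\<close>
    show "stem_differentiable (F1 \<Omega> f J) z"
      using U(1) by (intro stem_differentiable_transform[OF diff _ U(2) F1_eq[OF U(1) J _ KJ]])
        (simp_all add: stable_nbhd_def speared_open_RC_def)
  qed
  fix z assume "z \<in> D1 \<Omega> J"
  then obtain \<epsilon> U where U: "stable_nbhd \<Omega> f J \<epsilon> U" "z \<in> U"
    "z \<in> core_RC \<Omega> \<longrightarrow> U = core_RC \<Omega> \<and> \<epsilon> = 3" using ex by metis
  have core: "z \<in> core_RC \<Omega> \<longrightarrow> U = core_RC \<Omega> \<and> \<epsilon> = 3 \<and> Cap J \<epsilon> = imag_sphere"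
    using U(3) Cap_3[OF J] by blast
  have fam: "\<forall>J' \<in> Cap J \<epsilon>. \<forall>K' \<in> Cap J \<epsilon>. J' \<noteq> K' \<longrightarrow>
      U \<subseteq> D2 \<Omega> J' K' \<and> (\<forall>w\<in>U. F2 \<Omega> f J' K' w = F1 \<Omega> f J w)"
    using F1_eq[OF U(1) J] U(1) unfolding stable_nbhd_def by blast
  show "\<exists>\<epsilon>::real. \<exists>U :: complex set.
         \<epsilon> > 0 \<and> speared_open_RC U \<and> z \<in> U \<and> U \<subseteq> D1 \<Omega> J \<and>
         core_RC \<Omega> \<subseteq> U \<and>
         (U - core_RC \<Omega> \<subseteq> {w. Im w > 0} \<or> U - core_RC \<Omega> \<subseteq> {w. Im w < 0}) \<and>
         (\<forall>J' \<in> Cap J \<epsilon>. \<forall>K' \<in> Cap J \<epsilon>. J' \<noteq> K' \<longrightarrow>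
            U \<subseteq> D2 \<Omega> J' K' \<and> (\<forall>w\<in>U. F2 \<Omega> f J' K' w = F1 \<Omega> f J w)) \<and>
         (z \<in> core_RC \<Omega> \<longrightarrow> U = core_RC \<Omega> \<and> \<epsilon> = 3 \<and> Cap J \<epsilon> = imag_sphere)"
    using U(1,2) stable_nbhd_subset_D1[OF U(1) J] core fam unfolding stable_nbhd_def
    by (intro exI[of _ \<epsilon>] exI[of _ U] conjI) blast+
qed

end
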